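(* Let $A,B\in\mathbb{R}^{n\times n}$ and $c\in\mathbb{R}^n$, and let $Q\in\mathbb{R}^{n\times n}$ be nonsingular. Let $A=M-N$ and $Q=Q_1-Q_2$ with $M,N,Q_1,Q_2\in\mathbb{R}^{n\times n}$ and $M$, $Q_1$ nonsingular, and let $\tau>0$. Put $$\alpha=\|Q_1^{-1}Q_2\|,\quad \beta=\|Q_1^{-1}\|,\quad \gamma=\|M^{-1}N\|,\quad \mu=\|M^{-1}BQ_1\|,\quad \nu=\|M^{-1}BQ_2\|.$$ If $$\big|\,\gamma|1-\tau|+\tau(\gamma\alpha-\beta\nu)\big|<1\quad\text{and}\quad \tau(\mu\beta+\beta\nu)<(\gamma-1)\big(|1-\tau|+\tau\alpha-1\big),$$ then the system $Ax-B|x|-c=0$ has a unique solution $x^*\in\mathbb{R}^n$, and for all initial vectors $x^0,y^0\in\mathbb{R}^n$ the sequence $\{(x^k,y^k)\}_{k=0}^\infty$ generated by $$\begin{cases} y^{k+1}=(1-\tau)y^k+\tau Q_1^{-1}\left(Q_2y^k+|x^k|\right),\\ x^{k+1}=M^{-1}\left(Nx^k+BQ_1y^{k+1}-BQ_2y^k+c\right),\end{cases}\qquad k=0,1,2,\dots,$$ converges to $(x^*,y^* )$ with $y^*=Q^{-1}|x^*|$.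
   Context: For $x\in\mathbb{R}^n$, $|x|=(|x_1|,\dots,|x_n|)^\top$ is the componentwise absolute value. $\|\cdot\|$ denotes the Euclidean norm of vectors and the induced $2$-norm (spectral norm) of matrices. *)

theory Defs
  imports "HOL-Analysis.Analysis"
begin

(* The operator norm induced by the Euclidean norm, which is the norm of the type real^'n. *)
abbreviation spectral_norm :: "real ^ 'n ^ 'm \<Rightarrow> real" where
  "spectral_norm A \<equiv> onorm (\<lambda>x. A *v x)"

(* On real^'n, the absolute value of the ordered_euclidean_space instance is
   componentwise (abs_vec_def), so no separate notion is needed for the vector |x|. *)

end

theory Submission
  imports Defs
begin

text \<open>
  Let \<open>dx\<close>, \<open>dy\<close> be the norms of the componentwise differences of two iterates. One step of the
  iteration bounds the new pair \<open>(dx, dy)\<close> by the image of the old one under a nonnegative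
  \<open>2 \<times> 2\<close> matrix \<open>W\<close> with determinant \<open>\<gamma>\<bar>1 - \<tau>\<bar> + \<tau>(\<gamma>\<alpha> - \<beta>\<nu>)\<close>. The two hypotheses say
  \<open>\<bar>det W\<bar> < 1\<close> and \<open>tr W < 1 + det W\<close>, i.e. \<open>W\<close> has spectral radius below 1.
  Then a suitable weighted sum \<open>dx + s * dy\<close> contracts, so that the iteration has a globally
  attracting fixed point, and its fixed points are exactly the pairs \<open>(x, Q\<inverse>\<bar>x\<bar>)\<close> with \<open>x\<close> a
  solution of the equation.
\<close>

text \<open>With rows \<open>(a, b)\<close> and \<open>(c, d)\<close>, the row vector
  \<open>(1, s)\<close> is multiplied by the matrix from the left. At \<open>s = b / (1 - d)\<close>
  the second column would give exactly the factor 1 and the first less than 1, so a slightly larger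
  \<open>s\<close> makes both strict.\<close>

lemma contracting_weight_exists:
  fixes a b c d :: real
  assumes nonneg: "0 \<le> a" "0 \<le> b" "0 \<le> c" "0 \<le> d"
    and det: "a * d - b * c < 1" and tr: "a + d < 1 + (a * d - b * c)"
  shows "\<exists>s \<theta>. 0 < s \<and> 0 < \<theta> \<and> \<theta> < 1 \<and> a + s * c \<le> \<theta> \<and> b + s * d \<le> \<theta> * s"
proof -
  have "b * c < (1 - a) * (1 - d)"
    using tr by (simp add: algebra_simps)
  moreover have "0 \<le> b * c"
    using nonneg by simp
  ultimately have pos: "0 < (1 - a) * (1 - d)" by linarith
  \<comment> \<open>both factors negative would force \<open>a + d > 2\<close>, while \<open>a + d < 1 + (a * d - b * c) < 2\<close>\<close>
  then have lt1: "a < 1" "d < 1"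
    using det tr by (auto simp: zero_less_mult_iff)
  \<comment> \<open>The first column has slack \<open>((1 - a) * (1 - d) - b * c) / (1 - d)\<close>
    at \<open>s = b / (1 - d)\<close>, and raising \<open>s\<close> by \<open>\<epsilon>\<close>
    uses up \<open>\<epsilon> * c\<close> of it. Dividing by \<open>2 * (c + 1)\<close> keeps this
    below the slack and also covers \<open>c = 0\<close>.\<close>
  define \<epsilon> where "\<epsilon> = ((1 - a) * (1 - d) - b * c) / (2 * (1 - d) * (c + 1))"
  define s where "s = b / (1 - d) + \<epsilon>"
  have eps: "\<epsilon> > 0"
    using \<open>b * c < (1 - a) * (1 - d)\<close> lt1 nonneg by (simp add: \<epsilon>_def)
  have s: "s > 0"
    using eps nonneg lt1 by (simp add: s_def add_nonneg_pos)
  have "\<epsilon> * c < \<epsilon> * (2 * (c + 1))"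
    using eps nonneg by (intro mult_strict_left_mono) auto
  also have "\<dots> = ((1 - a) * (1 - d) - b * c) / (1 - d)"
  proof -
    have "e / (2 * p * q) * (2 * q) = e / p" if "q \<noteq> 0" for e p q :: real
      using that by simp
    then show ?thesis
      unfolding \<epsilon>_def using nonneg by (metis add_nonneg_pos less_irrefl zero_less_one)
  qed
  also have "\<dots> = (1 - a) - b / (1 - d) * c"
    using lt1 by (simp add: divide_simps)
  finally have col1: "a + s * c < 1"
    by (simp add: s_def algebra_simps)
  have "b = b / (1 - d) * (1 - d)"
    using lt1 by simp
  also have "\<dots> < s * (1 - d)"
    using eps lt1 by (intro mult_strict_right_mono) (auto simp: s_def)
  finally have col2: "(b + s * d) / s < 1"
    using s by (simp add: divide_simps algebra_simps)
  \<comment> \<open>The entry \<open>1 / 2\<close> keeps \<open>\<theta>\<close> positive when both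
    column quotients vanish.\<close>
  define \<theta> where "\<theta> = max (1 / 2) (max (a + s * c) ((b + s * d) / s))"
  have "(b + s * d) / s \<le> \<theta>"
    by (simp add: \<theta>_def)
  then have "b + s * d \<le> \<theta> * s"
    using s by (simp add: divide_simps)
  moreover have "a + s * c \<le> \<theta>" "0 < \<theta>" "\<theta> < 1"
    using col1 col2 by (auto simp: \<theta>_def)
  ultimately show ?thesis
    using s by blast
qed

text \<open>\<open>f\<close> may fail to contract the product metric, but it contracts the
  equivalent weighted metric \<open>V\<close>. Hence some iterate of \<open>f\<close> contracts the
  product metric, and Banach's theorem applies to that iterate.\<close>

lemma coupled_contraction_attracting_fixpoint:
  fixes f :: "'a::complete_space \<times> 'b::complete_space \<Rightarrow> 'a \<times> 'b"
    and a b c d :: real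
  assumes nonneg: "0 \<le> a" "0 \<le> b" "0 \<le> c" "0 \<le> d"
    and det: "a * d - b * c < 1" and tr: "a + d < 1 + (a * d - b * c)"
    and fst_le: "\<And>u v. dist (fst (f u)) (fst (f v)) \<le> a * dist (fst u) (fst v) + b * dist (snd u) (snd v)"
    and snd_le: "\<And>u v. dist (snd (f u)) (snd (f v)) \<le> c * dist (fst u) (fst v) + d * dist (snd u) (snd v)"
  shows "\<exists>w. f w = w \<and> (\<forall>u. (\<forall>k. u (Suc k) = f (u k)) \<longrightarrow> u \<longlonglongrightarrow> w)"
proof -
  obtain s \<theta> where s: "0 < s" and \<theta>: "0 < \<theta>" "\<theta> < 1"
    and col: "a + s * c \<le> \<theta>" "b + s * d \<le> \<theta> * s"
    using contracting_weight_exists[OF nonneg det tr] by blast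
  define V where "V u v = dist (fst u) (fst v) + s * dist (snd u) (snd v)" for u v :: "'a \<times> 'b"
  have V_step: "V (f u) (f v) \<le> \<theta> * V u v" for u v
  proof -
    have "V (f u) (f v) \<le> (a * dist (fst u) (fst v) + b * dist (snd u) (snd v))
        + s * (c * dist (fst u) (fst v) + d * dist (snd u) (snd v))"
      unfolding V_def using fst_le snd_le s by (intro add_mono mult_left_mono) auto
    also have "\<dots> = (a + s * c) * dist (fst u) (fst v) + (b + s * d) * dist (snd u) (snd v)"
      by (simp add: algebra_simps)
    also have "\<dots> \<le> \<theta> * dist (fst u) (fst v) + (\<theta> * s) * dist (snd u) (snd v)"
      using col by (intro add_mono mult_right_mono) auto
    finally show ?thesis
      by (simp add: V_def algebra_simps)
  qed
  have V_iter: "V ((f ^^ k) u) ((f ^^ k) v) \<le> \<theta> ^ k * V u v" for k u v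
  proof (induction k)
    case (Suc k)
    have "V ((f ^^ Suc k) u) ((f ^^ Suc k) v) \<le> \<theta> * V ((f ^^ k) u) ((f ^^ k) v)"
      using V_step by simp
    also have "\<dots> \<le> \<theta> * (\<theta> ^ k * V u v)"
      using Suc \<theta> by (intro mult_left_mono) auto
    finally show ?case by simp
  qed simp
  have dist_le: "dist u v \<le> (1 + 1 / s) * V u v" for u v
  proof -
    have "dist u v \<le> dist (fst u) (fst v) + dist (snd u) (snd v)"
      unfolding dist_prod_def by (rule sqrt_sum_squares_le_sum) auto
    also have "\<dots> \<le> (1 + 1 / s) * V u v"
      using s by (simp add: V_def divide_simps) (simp add: algebra_simps)
    finally show ?thesis .
  qed
  have V_le: "V u v \<le> (1 + s) * dist u v" for u v
    using add_mono[OF dist_fst_le[of u v] mult_left_mono[OF dist_snd_le[of u v], of s]] s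
    by (simp add: V_def algebra_simps)
  \<comment> \<open>The cost of passing from the product metric to \<open>V\<close> and back; it
    does not depend on the number of iterations.\<close>
  define K where "K = (1 + 1 / s) * (1 + s)"
  have K: "K > 0"
    using s by (simp add: K_def add_pos_pos)
  have dist_iter: "dist ((f ^^ k) u) ((f ^^ k) v) \<le> K * \<theta> ^ k * dist u v" for k u v
  proof -
    have "dist ((f ^^ k) u) ((f ^^ k) v) \<le> (1 + 1 / s) * V ((f ^^ k) u) ((f ^^ k) v)"
      by (rule dist_le)
    also have "\<dots> \<le> (1 + 1 / s) * (\<theta> ^ k * ((1 + s) * dist u v))"
      using s \<theta> V_le by (intro mult_left_mono order_trans[OF V_iter]) auto
    finally show ?thesis
      by (simp add: K_def mult_ac)
  qed
  have lim: "(\<lambda>k. K * \<theta> ^ k * r) \<longlonglongrightarrow> 0" for r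
    using \<theta> by (intro tendsto_mult_left_zero tendsto_mult_right_zero LIMSEQ_realpow_zero) auto
  have "\<forall>\<^sub>F k in sequentially. K * \<theta> ^ k * 1 < 1"
    using order_tendstoD(2)[OF lim, of 1 1] by simp
  then obtain m where m: "K * \<theta> ^ m < 1"
    by (auto simp: eventually_sequentially)
  have "\<exists>!w. (f ^^ m) w = w"
    by (rule banach_fix_type[where c = "K * \<theta> ^ m"]) (use K \<theta> m dist_iter[of m] in simp_all)
  then obtain w where w: "(f ^^ m) w = w" and uniq: "\<And>v. (f ^^ m) v = v \<Longrightarrow> v = w"
    by auto
  \<comment> \<open>Since \<open>f\<close> commutes with its iterate, \<open>f w\<close> is again a
    fixed point of \<open>f ^^ m\<close>, so uniqueness forces \<open>f w = w\<close>.\<close>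
  have "(f ^^ m) (f w) = f ((f ^^ m) w)"
    by (simp add: funpow_swap1)
  then have fw: "f w = w"
    using w by (intro uniq) simp
  then have iter_w: "(f ^^ k) w = w" for k
    by (induction k) auto
  have "u \<longlonglongrightarrow> w" if u: "\<And>k. u (Suc k) = f (u k)" for u
  proof -
    have orbit: "u k = (f ^^ k) (u 0)" for k
      by (induction k) (simp_all add: u)
    have "dist (u k) w \<le> K * \<theta> ^ k * dist (u 0) w" for k
      using dist_iter[of k "u 0" w] unfolding iter_w orbit[of k] .
    then have "(\<lambda>k. dist (u k) w) \<longlonglongrightarrow> 0"
      by (intro tendsto_sandwich[OF _ _ tendsto_const lim[of "dist (u 0) w"]]) auto
    then show ?thesis
      by (rule tendsto_dist_iff[THEN iffD2])
  qed
  then show ?thesis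
    using fw by blast
qed

text \<open>The reverse triangle inequality in each component. The nonlinearity enters the estimates
  only through this bound.\<close>

lemma norm_abs_diff_le:
  fixes x y :: "real ^ 'n"
  shows "norm (\<bar>x\<bar> - \<bar>y\<bar>) \<le> norm (x - y)"
  by (rule norm_le_componentwise_cart) (simp add: abs_vec_def abs_triangle_ineq3)

lemma norm_matrix_vector_mult_le:
  fixes A :: "real ^ 'n ^ 'm"
  shows "norm (A *v x) \<le> spectral_norm A * norm x"
  by (intro onorm matrix_vector_mul_bounded_linear)

lemma spectral_norm_nonneg:
  fixes A :: "real ^ 'n ^ 'm"
  shows "0 \<le> spectral_norm A"
  by (intro onorm_pos_le matrix_vector_mul_bounded_linear)

lemma matrix_inv_vector_mult:
  fixes A :: "real ^ 'n ^ 'n"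
  assumes "invertible A"
  shows "A *v (matrix_inv A *v x) = x" "matrix_inv A *v (A *v x) = x"
proof -
  have "A ** matrix_inv A = mat 1 \<and> matrix_inv A ** A = mat 1"
    using assms unfolding matrix_inv_def invertible_def by (rule someI_ex)
  then show "A *v (matrix_inv A *v x) = x" "matrix_inv A *v (A *v x) = x"
    by (simp_all add: matrix_vector_mul_assoc)
qed

theorem theorem3p1:
  fixes A B M N Q Q1 Q2 :: "real ^ 'n ^ 'n"
    and c :: "real ^ 'n"
    and \<tau> \<alpha> \<beta> \<gamma> \<mu> \<nu> :: real
  assumes "invertible Q"
    and "A = M - N"
    and "Q = Q1 - Q2"
    and "invertible M"
    and "invertible Q1"
    and "\<tau> > 0"
    and "\<alpha> = spectral_norm (matrix_inv Q1 ** Q2)"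
    and "\<beta> = spectral_norm (matrix_inv Q1)"
    and "\<gamma> = spectral_norm (matrix_inv M ** N)"
    and "\<mu> = spectral_norm (matrix_inv M ** B ** Q1)"
    and "\<nu> = spectral_norm (matrix_inv M ** B ** Q2)"
    and "\<bar>\<gamma> * \<bar>1 - \<tau>\<bar> + \<tau> * (\<gamma> * \<alpha> - \<beta> * \<nu>)\<bar> < 1"
    and "\<tau> * (\<mu> * \<beta> + \<beta> * \<nu>) < (\<gamma> - 1) * (\<bar>1 - \<tau>\<bar> + \<tau> * \<alpha> - 1)"
  shows "\<exists>xs :: real ^ 'n.
      A *v xs - B *v \<bar>xs\<bar> - c = 0 \<and>
      (\<forall>z :: real ^ 'n. A *v z - B *v \<bar>z\<bar> - c = 0 \<longrightarrow> z = xs) \<and>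
      (\<forall>x0 y0 :: real ^ 'n. \<forall>x y :: nat \<Rightarrow> real ^ 'n.
         x 0 = x0 \<and> y 0 = y0 \<and>
         (\<forall>k. y (Suc k) = (1 - \<tau>) *\<^sub>R y k + \<tau> *\<^sub>R (matrix_inv Q1 *v (Q2 *v y k + \<bar>x k\<bar>))) \<and>
         (\<forall>k. x (Suc k) = matrix_inv M *v
                (N *v x k + (B ** Q1) *v y (Suc k) - (B ** Q2) *v y k + c))
         \<longrightarrow> (\<lambda>k. (x k, y k)) \<longlonglongrightarrow> (xs, matrix_inv Q *v \<bar>xs\<bar>))"
proof -
  note nonsing = \<open>invertible Q\<close> \<open>invertible M\<close> \<open>invertible Q1\<close>
  note inv = matrix_inv_vector_mult[OF nonsing(1)] matrix_inv_vector_mult[OF nonsing(2)]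
    matrix_inv_vector_mult[OF nonsing(3)]
  note tau = \<open>\<tau> > 0\<close>
  note mv = matrix_vector_mult_diff_distrib matrix_vector_right_distrib
    matrix_vector_mul_assoc[symmetric] matrix_vector_mult_diff_rdistrib
  define Y where "Y x y = (1 - \<tau>) *\<^sub>R y + \<tau> *\<^sub>R (matrix_inv Q1 *v (Q2 *v y + \<bar>x\<bar>))"
    for x y :: "real ^ 'n"
  \<comment> \<open>The new \<open>x\<close> is computed from the already updated \<open>y\<close>,
    hence the occurrence of \<open>Y x y\<close>.\<close>
  define X where "X x y = matrix_inv M *v (N *v x + (B ** Q1) *v Y x y - (B ** Q2) *v y + c)"
    for x y :: "real ^ 'n"
  define f where "f u = (X (fst u) (snd u), Y (fst u) (snd u))" for u
  define p where "p = \<bar>1 - \<tau>\<bar> + \<tau> * \<alpha>"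
  have nonneg: "0 \<le> \<alpha>" "0 \<le> \<beta>" "0 \<le> \<gamma>" "0 \<le> \<mu>" "0 \<le> \<nu>"
    using assms(7-11) by (simp_all add: spectral_norm_nonneg)
  then have "0 \<le> p"
    using tau by (simp add: p_def)
  have Y_le: "dist (Y x y) (Y x' y') \<le> \<tau> * \<beta> * dist x x' + p * dist y y'" for x y x' y'
  proof -
    have "Y x y - Y x' y' = (1 - \<tau>) *\<^sub>R (y - y') + \<tau> *\<^sub>R ((matrix_inv Q1 ** Q2) *v (y - y'))
        + \<tau> *\<^sub>R (matrix_inv Q1 *v (\<bar>x\<bar> - \<bar>x'\<bar>))"
      by (simp add: Y_def mv scaleR_right_distrib scaleR_right_diff_distrib)
    also have "norm \<dots> \<le> \<bar>1 - \<tau>\<bar> * norm (y - y') + \<tau> * norm ((matrix_inv Q1 ** Q2) *v (y - y'))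
        + \<tau> * norm (matrix_inv Q1 *v (\<bar>x\<bar> - \<bar>x'\<bar>))"
      using tau by (intro norm_triangle_le add_mono) auto
    also have "\<dots> \<le> \<bar>1 - \<tau>\<bar> * norm (y - y') + \<tau> * (\<alpha> * norm (y - y')) + \<tau> * (\<beta> * norm (x - x'))"
    proof (intro add_mono mult_left_mono order_refl)
      show "norm ((matrix_inv Q1 ** Q2) *v (y - y')) \<le> \<alpha> * norm (y - y')"
        unfolding assms(7) by (rule norm_matrix_vector_mult_le)
      have "norm (matrix_inv Q1 *v (\<bar>x\<bar> - \<bar>x'\<bar>)) \<le> \<beta> * norm (\<bar>x\<bar> - \<bar>x'\<bar>)"
        unfolding assms(8) by (rule norm_matrix_vector_mult_le)
      also have "\<dots> \<le> \<beta> * norm (x - x')"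
        using nonneg by (intro mult_left_mono norm_abs_diff_le)
      finally show "norm (matrix_inv Q1 *v (\<bar>x\<bar> - \<bar>x'\<bar>)) \<le> \<beta> * norm (x - x')" .
    qed (use tau in auto)
    finally show ?thesis
      by (simp add: dist_norm p_def algebra_simps)
  qed
  \<comment> \<open>Inserting \<open>Y_le\<close> for the updated \<open>y\<close> adds
    \<open>\<mu>\<close> times the second row \<open>(\<tau> * \<beta>, p)\<close> of
    \<open>W\<close> to the row \<open>(\<gamma>, \<nu>)\<close>.\<close>
  have X_le: "dist (X x y) (X x' y') \<le> (\<gamma> + \<mu> * (\<tau> * \<beta>)) * dist x x' + (\<mu> * p + \<nu>) * dist y y'"
    for x y x' y'
  proof -
    have "X x y - X x' y' = (matrix_inv M ** N) *v (x - x')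
        + (matrix_inv M ** B ** Q1) *v (Y x y - Y x' y') - (matrix_inv M ** B ** Q2) *v (y - y')"
      by (simp add: X_def mv)
    also have "norm \<dots> \<le> \<gamma> * norm (x - x') + \<mu> * norm (Y x y - Y x' y') + \<nu> * norm (y - y')"
      unfolding assms(9-11)
      by (intro norm_triangle_le norm_triangle_le_diff add_mono norm_matrix_vector_mult_le)
    also have "\<dots> \<le> \<gamma> * norm (x - x') + \<mu> * (\<tau> * \<beta> * norm (x - x') + p * norm (y - y'))
        + \<nu> * norm (y - y')"
      using Y_le[of x y x' y'] nonneg by (simp add: dist_norm mult_left_mono)
    finally show ?thesis
      by (simp add: dist_norm algebra_simps)
  qed
  \<comment> \<open>Row reduction removes \<open>\<mu>\<close>: the determinant is that of the rows
    \<open>(\<gamma>, \<nu>)\<close> and \<open>(\<tau> * \<beta>, p)\<close>, namely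
    \<open>\<gamma> * p - \<nu> * \<tau> * \<beta>\<close>.\<close>
  have det_eq: "(\<gamma> + \<mu> * (\<tau> * \<beta>)) * p - (\<mu> * p + \<nu>) * (\<tau> * \<beta>)
      = \<gamma> * \<bar>1 - \<tau>\<bar> + \<tau> * (\<gamma> * \<alpha> - \<beta> * \<nu>)"
    by (simp add: p_def algebra_simps)
  have det: "(\<gamma> + \<mu> * (\<tau> * \<beta>)) * p - (\<mu> * p + \<nu>) * (\<tau> * \<beta>) < 1"
    unfolding det_eq using assms(12) by linarith
  \<comment> \<open>Expanding \<open>(\<gamma> - 1) * (p - 1)\<close> in the second hypothesis and
    moving \<open>\<tau> * \<beta> * \<nu>\<close> to the right gives the trace condition.\<close>
  have tr: "(\<gamma> + \<mu> * (\<tau> * \<beta>)) + p < 1 + ((\<gamma> + \<mu> * (\<tau> * \<beta>)) * p - (\<mu> * p + \<nu>) * (\<tau> * \<beta>))"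
    using assms(13) unfolding p_def[symmetric] by (simp add: algebra_simps)
  have "\<exists>w. f w = w \<and> (\<forall>u. (\<forall>k. u (Suc k) = f (u k)) \<longrightarrow> u \<longlonglongrightarrow> w)"
    by (rule coupled_contraction_attracting_fixpoint[OF _ _ _ _ det tr])
      (use nonneg tau \<open>0 \<le> p\<close> X_le Y_le in \<open>auto simp: f_def\<close>)
  then obtain w where fw: "f w = w"
    and attr: "\<And>u. (\<And>k. u (Suc k) = f (u k)) \<Longrightarrow> u \<longlonglongrightarrow> w"
    by blast
  obtain xs ys where w: "w = (xs, ys)"
    by fastforce
  \<comment> \<open>Cancelling \<open>\<tau>\<close> and applying \<open>Q1\<close> turns the
    \<open>y\<close> equation into \<open>Q *v y = \<bar>x\<bar>\<close>. Then the two
    \<open>B\<close> terms of the \<open>x\<close> equation combine to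
    \<open>B *v \<bar>x\<bar>\<close>.\<close>
  have fixed: "Q *v y = \<bar>x\<bar>" "A *v x - B *v \<bar>x\<bar> - c = 0" if "f (x, y) = (x, y)" for x y
  proof -
    have eqs: "Y x y = y" "X x y = x"
      using that by (auto simp: f_def)
    have "\<tau> *\<^sub>R (matrix_inv Q1 *v (Q2 *v y + \<bar>x\<bar>)) = \<tau> *\<^sub>R y"
      using eqs(1) by (simp add: Y_def algebra_simps)
    then have "matrix_inv Q1 *v (Q2 *v y + \<bar>x\<bar>) = y"
      using tau by simp
    then have "Q1 *v y = Q2 *v y + \<bar>x\<bar>"
      using inv by metis
    then show Qy: "Q *v y = \<bar>x\<bar>"
      by (simp add: assms(3) mv)
    have "M *v x = N *v x + (B ** Q1) *v y - (B ** Q2) *v y + c"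
      using eqs inv by (metis X_def)
    also have "\<dots> = N *v x + B *v (Q *v y) + c"
      by (simp add: assms(3) mv)
    finally show "A *v x - B *v \<bar>x\<bar> - c = 0"
      by (simp add: Qy assms(2) mv)
  qed
  have ys: "ys = matrix_inv Q *v \<bar>xs\<bar>"
    using fixed(1)[of xs ys] fw w inv by metis
  have uniq: "z = xs" if z: "A *v z - B *v \<bar>z\<bar> - c = 0" for z
  proof -
    define y where "y = matrix_inv Q *v \<bar>z\<bar>"
    have Qy: "Q *v y = \<bar>z\<bar>"
      by (simp add: y_def inv)
    then have "Q2 *v y + \<bar>z\<bar> = Q1 *v y"
      by (simp add: assms(3) mv algebra_simps)
    then have Y: "Y z y = y"
      by (simp add: Y_def inv algebra_simps)
    have "N *v z + (B ** Q1) *v y - (B ** Q2) *v y + c = N *v z + B *v (Q *v y) + c"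
      by (simp add: assms(3) mv)
    also have "\<dots> = M *v z"
      using z by (simp add: Qy assms(2) mv algebra_simps)
    finally have "X z y = z"
      by (simp add: X_def Y inv)
    \<comment> \<open>A solution \<open>z\<close> yields the fixed point \<open>(z, y)\<close> of
      \<open>f\<close>. Its constant orbit is attracted to \<open>w\<close>, so
      \<open>(z, y) = w\<close>.\<close>
    then have "(\<lambda>k::nat. (z, y)) \<longlonglongrightarrow> w"
      by (intro attr) (simp add: f_def Y)
    then show ?thesis
      by (simp add: w LIMSEQ_const_iff)
  qed
  have conv: "(\<lambda>k. (x k, y k)) \<longlonglongrightarrow> (xs, matrix_inv Q *v \<bar>xs\<bar>)"
    if "\<And>k. y (Suc k) = (1 - \<tau>) *\<^sub>R y k + \<tau> *\<^sub>R (matrix_inv Q1 *v (Q2 *v y k + \<bar>x k\<bar>))"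
      and "\<And>k. x (Suc k) = matrix_inv M *v (N *v x k + (B ** Q1) *v y (Suc k) - (B ** Q2) *v y k + c)"
    for x y :: "nat \<Rightarrow> real ^ 'n"
  proof -
    have "(\<lambda>k. (x k, y k)) \<longlonglongrightarrow> w"
      by (rule attr) (simp add: f_def X_def Y_def that)
    then show ?thesis
      by (simp add: w ys)
  qed
  show ?thesis
    using fixed(2)[of xs ys] fw w uniq conv by blast
qed

end
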